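(* Consider the deferred correction splitting (DC--S) scheme described in the context, with time step $\Delta t>0$, based on an $s$-stage stiffly accurate collocation quadrature of order $p$ and stage order $q$ and on a splitting approximation of order $\widehat p$, for the problem $\mathrm{d}_t u=F(u)$, $u(t_0)=u_0$, under the assumptions (i)--(vi) listed in the context with constants $C_1,\dots,C_6$. If $C_1<1$ in (ii) and $C_6\,\Delta t<1$ in (vi), then for $k=1,2,\ldots$ the following bound holds: $$\bigl\|u(t_0+\Delta t)-\widetilde u_s^{\,k}\bigr\|\le c\,\Delta t^{\min[p+1,\;q+2,\;\widehat p+k+1]},$$ with a constant $c$, not depending on $\Delta t$, satisfying $c\ge\max\{C_3,\;C_2C_6,\;s\,C_4C_1\}$.
   Context: Setting. $X$ is a Banach space with norm $\|\cdot\|$ (the problem is a semi-discrete one, considered in a finite dimensional setting, e.g. $X=\mathbb{R}^{mN}$), $F$ is a nonlinear operator from $D(F)\subset X$ to $X$, and $u(t)\in X$ is the solution of $\mathrm{d}_t u=F(u)$, $t>t_0$, $u(t_0)=u_0$. The exact solution operator is denoted $\mathcal T^{t}$, so that $\mathcal T^{t}v$ is the solution after time $t$ starting from $v$. $\mathcal S^{t}$ denotes a splitting approximation of order $\widehat p$ of $\mathcal T^t$ (e.g. for $F=F_1+F_2$ with subflows $X^t,Y^t$: Lie $X^tY^t$ or $Y^tX^t$, $\widehat p=1$; Strang $X^{t/2}Y^tX^{t/2}$ or $Y^{t/2}X^tY^{t/2}$, $\widehat p=2$). Quadrature. Let $0=c_0<c_1<\dots<c_s=1$ be the nodes and $(a_{ij})_{1\le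 i,j\le s}$, $(b_j)$ the coefficients of an $s$-stage implicit Runge--Kutta collocation scheme that is stiffly accurate ($a_{sj}=b_j$), of order $p$ ($\int_0^1\pi\,d\tau=\sum_j b_j\pi(c_j)$ for polynomials $\pi$ of degree $\le p-1$) and of stage order $q$ ($\int_0^{c_i}\pi\,d\tau=\sum_j a_{ij}\pi(c_j)$ for polynomials of degree $\le q-1$, $i=1,\dots,s$); e.g. RadauIIA with $p=2s-1$, $q=s$. For a time step $\Delta t$ put $t_i=t_0+c_i\Delta t$. For $U=(u_j)_{j=1,\dots,s}$ put $I_{t_0}^{t_i}(U)=\Delta t\sum_{j=1}^s a_{ij}F(u_j)$, $I_{t_0}^{t_0}(U)=0$, and $I_{t_{i-1}}^{t_i}(U)=I_{t_0}^{t_i}(U)-I_{t_0}^{t_{i-1}}(U)$. DC--S scheme. Initialization: $\widetilde u_1^{\,0}=\mathcal S^{c_1\Delta t}u_0$, $\widetilde u_i^{\,0}=\mathcal S^{(c_i-c_{i-1})\Delta t}\widetilde u_{i-1}^{\,0}$ for $i=2,\dots,s$. Iteration: with $\widetilde U^k=(\widetilde u_i^{\,k})_{i=1,\dots,s}$, $\widetilde u_0^{\,k}=u_0$ and $\widehat u_i^{\,k}=\widetilde u_{i-1}^{\,k}+I_{t_{i-1}}^{t_i}(\widetilde U^k)$, $$\widetilde u_1^{\,k+1}=\widehat u_1^{\,k},\qquad \widetilde u_i^{\,k+1}=\widehat u_i^{\,k}+\mathcal S^{(c_i-c_{i-1})\Delta t}\widetilde u_{i-1}^{\,k+1}-\mathcal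 S^{(c_i-c_{i-1})\Delta t}\widetilde u_{i-1}^{\,k},\quad i=2,\dots,s.$$ Assumptions, with positive constants not depending on $\Delta t$ (the bounds (iv)--(vi) are written for a generic step $\Delta t$ and generic data $u_0,v_0$, and are assumed also for the substeps): (i) $\|F(u)-F(v)\|\le\kappa\|u-v\|$. (ii) Consequently, $\|I_{t_{i-1}}^{t_i}(U)-I_{t_{i-1}}^{t_i}(V)\|\le C_1\Delta t\sum_{j=1}^s\|u_j-v_j\|$, $i=1,\dots,s$. (iii) $\bigl\|\int_{t_{i-1}}^{t_i}F(u(\tau))\,d\tau-I_{t_{i-1}}^{t_i}[(u(t_j))_{j}]\bigr\|\le C_2\Delta t^{q+1}$ for $i=1,\dots,s$, and $\bigl\|\int_{t_0}^{t_s}F(u(\tau))\,d\tau-I_{t_0}^{t_s}[(u(t_j))_{j}]\bigr\|\le C_3\Delta t^{p+1}$, where $u$ is the exact solution. (iv) $\|\mathcal T^{\Delta t}u_0-\mathcal S^{\Delta t}u_0\|\le C_4\Delta t^{\widehat p+1}$. (v) $\|\mathcal T^{\Delta t}u_0-\mathcal S^{\Delta t}u_0-[\mathcal T^{\Delta t}v_0-\mathcal S^{\Delta t}v_0]\|\le C_5\Delta t^{\widehat p+1}\|u_0-v_0\|$. (vi) $\|\mathcal S^{\Delta t}u_0-\mathcal S^{\Delta t}v_0\|\le(1+C_6\Delta t)\|u_0-v_0\|$. *)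

theory Defs
  imports "HOL-Analysis.Analysis" "HOL-Computational_Algebra.Polynomial"
begin

text \<open>
  The data of the evolution problem: \<open>D\<close> is the domain of \<open>F\<close>; only the values of \<open>F\<close> on \<open>D\<close>
  are meaningful.
\<close>

definition solves_ode :: "'a::banach set \<Rightarrow> ('a \<Rightarrow> 'a) \<Rightarrow> real \<Rightarrow> 'a \<Rightarrow> (real \<Rightarrow> 'a) \<Rightarrow> bool" where
  "solves_ode D F t0 u0 u \<longleftrightarrow>
     u t0 = u0 \<and> continuous_on {t0..} u \<and> (\<forall>t\<ge>t0. u t \<in> D) \<and>
     (\<forall>t>t0. (u has_vector_derivative F (u t)) (at t))"

definition solution_operator :: "'a::banach set \<Rightarrow> ('a \<Rightarrow> 'a) \<Rightarrow> (real \<Rightarrow> 'a \<Rightarrow> 'a) \<Rightarrow> bool" where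
  "solution_operator D F T \<longleftrightarrow> (\<forall>v\<in>D. solves_ode D F 0 v (\<lambda>t. T t v))"

text \<open>
  Collocation quadrature with nodes \<open>c 0 = 0 < c 1 < \<dots> < c s = 1\<close>. The stages carry the indices
  \<open>1, \<dots>, s\<close>; \<open>c 0\<close> is not a stage.
\<close>

definition lagrange_basis :: "nat \<Rightarrow> (nat \<Rightarrow> real) \<Rightarrow> nat \<Rightarrow> real \<Rightarrow> real" where
  "lagrange_basis s c j \<tau> = (\<Prod>m\<in>{1..s} - {j}. (\<tau> - c m) / (c j - c m))"

definition collocation_nodes :: "nat \<Rightarrow> (nat \<Rightarrow> real) \<Rightarrow> bool" where
  "collocation_nodes s c \<longleftrightarrow> 1 \<le> s \<and> c 0 = 0 \<and> c s = 1 \<and> (\<forall>i<s. c i < c (Suc i))"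

definition collocation_coeffs ::
    "nat \<Rightarrow> (nat \<Rightarrow> real) \<Rightarrow> (nat \<Rightarrow> nat \<Rightarrow> real) \<Rightarrow> (nat \<Rightarrow> real) \<Rightarrow> bool" where
  "collocation_coeffs s c a b \<longleftrightarrow>
     (\<forall>i\<in>{1..s}. \<forall>j\<in>{1..s}. a i j = integral {0..c i} (lagrange_basis s c j)) \<and>
     (\<forall>j\<in>{1..s}. b j = integral {0..1} (lagrange_basis s c j))"

definition stiffly_accurate :: "nat \<Rightarrow> (nat \<Rightarrow> nat \<Rightarrow> real) \<Rightarrow> (nat \<Rightarrow> real) \<Rightarrow> bool" where
  "stiffly_accurate s a b \<longleftrightarrow> (\<forall>j\<in>{1..s}. a s j = b j)"

text \<open>
  Exactness for polynomials of degree at most \<open>p - 1\<close> is written \<open>degree \<pi> < p\<close>, which avoids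
  truncated subtraction.
\<close>

definition quadrature_order :: "nat \<Rightarrow> (nat \<Rightarrow> real) \<Rightarrow> (nat \<Rightarrow> real) \<Rightarrow> nat \<Rightarrow> bool" where
  "quadrature_order s c b p \<longleftrightarrow>
     (\<forall>\<pi> :: real poly. degree \<pi> < p \<longrightarrow>
        integral {0..1} (poly \<pi>) = (\<Sum>j=1..s. b j * poly \<pi> (c j)))"

definition stage_order :: "nat \<Rightarrow> (nat \<Rightarrow> real) \<Rightarrow> (nat \<Rightarrow> nat \<Rightarrow> real) \<Rightarrow> nat \<Rightarrow> bool" where
  "stage_order s c a q \<longleftrightarrow>
     (\<forall>\<pi> :: real poly. degree \<pi> < q \<longrightarrow>
        (\<forall>i\<in>{1..s}. integral {0..c i} (poly \<pi>) = (\<Sum>j=1..s. a i j * poly \<pi> (c j))))"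

text \<open>\<open>quad_from0 \<dots> i U\<close> is \<open>I\<close> from \<open>t\<^sub>0\<close> to \<open>t\<^sub>i\<close>; \<open>quad_sub \<dots> i U\<close> is \<open>I\<close> from
  \<open>t\<^sub>i\<^sub>-\<^sub>1\<close> to \<open>t\<^sub>i\<close>, meant for \<open>i \<ge> 1\<close>.\<close>

definition quad_from0 ::
    "nat \<Rightarrow> (nat \<Rightarrow> nat \<Rightarrow> real) \<Rightarrow> ('a::banach \<Rightarrow> 'a) \<Rightarrow> real \<Rightarrow> nat \<Rightarrow> (nat \<Rightarrow> 'a) \<Rightarrow> 'a" where
  "quad_from0 s a F \<Delta>t i U = (if i = 0 then 0 else \<Delta>t *\<^sub>R (\<Sum>j=1..s. a i j *\<^sub>R F (U j)))"

definition quad_sub ::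
    "nat \<Rightarrow> (nat \<Rightarrow> nat \<Rightarrow> real) \<Rightarrow> ('a::banach \<Rightarrow> 'a) \<Rightarrow> real \<Rightarrow> nat \<Rightarrow> (nat \<Rightarrow> 'a) \<Rightarrow> 'a" where
  "quad_sub s a F \<Delta>t i U = quad_from0 s a F \<Delta>t i U - quad_from0 s a F \<Delta>t (i - 1) U"

text \<open>The scheme, with \<open>S t\<close> the splitting approximation over a step of length \<open>t\<close>.\<close>

primrec dcs_init ::
    "(nat \<Rightarrow> real) \<Rightarrow> (real \<Rightarrow> 'a \<Rightarrow> 'a) \<Rightarrow> 'a \<Rightarrow> real \<Rightarrow> nat \<Rightarrow> 'a::banach" where
  "dcs_init c S u0 \<Delta>t 0 = u0"
| "dcs_init c S u0 \<Delta>t (Suc i) = S ((c (Suc i) - c i) * \<Delta>t) (dcs_init c S u0 \<Delta>t i)"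

definition dcs_hat ::
    "nat \<Rightarrow> (nat \<Rightarrow> nat \<Rightarrow> real) \<Rightarrow> ('a::banach \<Rightarrow> 'a) \<Rightarrow> real \<Rightarrow> (nat \<Rightarrow> 'a) \<Rightarrow> nat \<Rightarrow> 'a" where
  "dcs_hat s a F \<Delta>t U i = U (i - 1) + quad_sub s a F \<Delta>t i U"

fun dcs_sweep ::
    "nat \<Rightarrow> (nat \<Rightarrow> real) \<Rightarrow> (nat \<Rightarrow> nat \<Rightarrow> real) \<Rightarrow> ('a::banach \<Rightarrow> 'a) \<Rightarrow> (real \<Rightarrow> 'a \<Rightarrow> 'a) \<Rightarrow> 'a \<Rightarrow>
     real \<Rightarrow> (nat \<Rightarrow> 'a) \<Rightarrow> nat \<Rightarrow> 'a" where
  "dcs_sweep s c a F S u0 \<Delta>t U 0 = u0"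
| "dcs_sweep s c a F S u0 \<Delta>t U (Suc 0) = dcs_hat s a F \<Delta>t U 1"
| "dcs_sweep s c a F S u0 \<Delta>t U (Suc (Suc i)) =
     dcs_hat s a F \<Delta>t U (Suc (Suc i))
     + S ((c (Suc (Suc i)) - c (Suc i)) * \<Delta>t) (dcs_sweep s c a F S u0 \<Delta>t U (Suc i))
     - S ((c (Suc (Suc i)) - c (Suc i)) * \<Delta>t) (U (Suc i))"

primrec dcs ::
    "nat \<Rightarrow> (nat \<Rightarrow> real) \<Rightarrow> (nat \<Rightarrow> nat \<Rightarrow> real) \<Rightarrow> ('a::banach \<Rightarrow> 'a) \<Rightarrow> (real \<Rightarrow> 'a \<Rightarrow> 'a) \<Rightarrow> 'a \<Rightarrow>
     real \<Rightarrow> nat \<Rightarrow> nat \<Rightarrow> 'a" where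
  "dcs s c a F S u0 \<Delta>t 0 = dcs_init c S u0 \<Delta>t"
| "dcs s c a F S u0 \<Delta>t (Suc k) = dcs_sweep s c a F S u0 \<Delta>t (dcs s c a F S u0 \<Delta>t k)"

text \<open>The lengths at which bounds on a single splitting step are required when the scheme is run
  with time step \<open>\<Delta>t\<close>: the step itself and its substeps.\<close>

definition step_lengths :: "nat \<Rightarrow> (nat \<Rightarrow> real) \<Rightarrow> real \<Rightarrow> real set" where
  "step_lengths s c \<Delta>t = insert \<Delta>t ((\<lambda>i. (c i - c (i - 1)) * \<Delta>t) ` {1..s})"

end

theory Submission
  imports Defs
begin

text \<open>
  Write \<open>e\<^sub>i\<^sup>k\<close> for the error at node \<open>i\<close> after \<open>k\<close> sweeps and \<open>\<delta>\<^sub>i\<close> for the quadrature defect of the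
  exact solution on the \<open>i\<close>-th subinterval. A sweep satisfies
  \<open>e\<^sub>i\<^sup>k\<^sup>+\<^sup>1 - e\<^sub>i\<^sub>-\<^sub>1\<^sup>k\<^sup>+\<^sup>1 = \<delta>\<^sub>i + O(\<Delta>t) (\<parallel>e\<^sup>k\<parallel> + \<parallel>e\<^sup>k\<^sup>+\<^sup>1\<parallel>)\<close>, because \<open>\<S> - id\<close> is Lipschitz with constant
  \<open>O(\<Delta>t)\<close>: this holds for the exact flow by Gronwall and is transferred to \<open>\<S>\<close> by (v). A discrete
  Gronwall argument with \<open>\<delta>\<^sub>i = O(\<Delta>t\<^sup>q\<^sup>+\<^sup>1)\<close> shows that every stage error is of order
  \<open>min (q + 1) (ph + k + 1)\<close>. Summing the same identity over all nodes, the \<open>\<delta>\<^sub>i\<close> telescope to the defect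
  \<open>O(\<Delta>t\<^sup>p\<^sup>+\<^sup>1)\<close> of the full step, while the remainder gains a factor \<open>\<Delta>t\<close> over the stage errors. Powers of
  \<open>\<Delta>t\<close> are exchanged freely since \<open>\<Delta>t < 1 / C6\<close>.
\<close>

section \<open>Elementary inequalities and the discrete Gronwall lemma\<close>

lemma norm_add_diff_le:
  fixes x y z :: "'a::real_normed_vector"
  shows "norm (x + y - z) \<le> norm x + norm y + norm z"
  using norm_triangle_ineq4[of "x + y" z] norm_triangle_ineq[of x y] by linarith

text \<open>Lowers the exponent of a bounded time step at the price of a constant, so that error
  terms of different orders can be merged under the smallest one.\<close>

lemma power_le_bounded:
  fixes x M :: real
  assumes "0 \<le> x" "x \<le> M" "n \<le> m"
  shows "x ^ m \<le> M ^ (m - n) * x ^ n"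
proof -
  have "x ^ m = x ^ (m - n) * x ^ n"
    using assms(3) by (simp flip: power_add)
  also have "\<dots> \<le> M ^ (m - n) * x ^ n"
    using assms by (intro mult_right_mono power_mono) auto
  finally show ?thesis .
qed

text \<open>Unrolling the recursion collects one \<open>\<beta>\<close> per step, each amplified by
  at most \<open>G ^ i\<close>. The crude bound \<open>i * G ^ i\<close> replaces the geometric sum,
  so \<open>G = 1\<close> is no exception.\<close>

lemma discrete_gronwall:
  fixes E :: "nat \<Rightarrow> real"
  assumes "E 0 \<le> 0" "1 \<le> G" "0 \<le> \<beta>"
    and step: "\<And>i. i \<in> {1..s} \<Longrightarrow> E i \<le> G * E (i - 1) + \<beta>"
    and "i \<le> s"
  shows "E i \<le> real s * G ^ s * \<beta>"
proof -
  have "E i \<le> real i * G ^ i * \<beta>"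
    using \<open>i \<le> s\<close>
  proof (induction i)
    case (Suc i)
    have "E (Suc i) \<le> G * E i + \<beta>"
      using step[of "Suc i"] Suc.prems by simp
    \<comment> \<open>Enlarging \<open>\<beta>\<close> by \<open>G ^ Suc i \<ge> 1\<close> gives
      both summands a common factor.\<close>
    also have "\<dots> \<le> G * (real i * G ^ i * \<beta>) + G ^ Suc i * \<beta>"
      using Suc assms(2,3) one_le_power[OF assms(2), of "Suc i"]
      by (intro add_mono mult_left_mono) (use mult_right_mono[of 1 "G ^ Suc i" \<beta>] in auto)
    finally show ?case by (simp add: algebra_simps)
  qed (use assms in auto)
  also have "\<dots> \<le> real s * G ^ s * \<beta>"
    using assms by (intro mult_right_mono mult_mono power_increasing) auto
  finally show ?thesis .
qed

section \<open>Continuous Gronwall estimates and the exact flow\<close>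

lemma norm_diff_le_of_derivative_bound:
  fixes z :: "real \<Rightarrow> 'a::banach"
  assumes "x \<le> y" "continuous_on {x..y} z"
    and "\<And>t. x < t \<Longrightarrow> t < y \<Longrightarrow> (z has_vector_derivative z' t) (at t)"
    and "\<And>t. x < t \<Longrightarrow> t < y \<Longrightarrow> norm (z' t) \<le> m"
  shows "norm (z y - z x) \<le> m * (y - x)"
proof (cases "x = y")
  case False
  with \<open>x \<le> y\<close> have "x < y" by simp
  have "((\<lambda>t. m * t) has_vector_derivative m) (at t)" for t
    by (rule has_real_derivative_iff_has_vector_derivative[THEN iffD1])
       (auto intro!: derivative_eq_intros)
  moreover have "continuous_on {x..y} (\<lambda>t. m * t)"
    by (intro continuous_intros)
  ultimately have "norm (z y - z x) \<le> m * y - m * x"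
    using \<open>x < y\<close> assms(2-4) by (intro differentiable_bound_general[where f = z and f' = z'])
  then show ?thesis by (simp add: right_diff_distrib)
qed simp

text \<open>A Gronwall bound without exponentials: over a time \<open>1 / (2\<kappa>)\<close> the norm at most doubles.\<close>

lemma norm_growth_doubling:
  fixes z :: "real \<Rightarrow> 'a::banach"
  assumes cont: "continuous_on {0..} z"
    and deriv: "\<And>t. 0 < t \<Longrightarrow> (z has_vector_derivative z' t) (at t)"
    and bound: "\<And>t. 0 < t \<Longrightarrow> norm (z' t) \<le> \<kappa> * norm (z t)"
    and \<kappa>: "0 < \<kappa>"
    and "0 \<le> t" "2 * \<kappa> * t \<le> real n"
  shows "norm (z t) \<le> 2 ^ n * norm (z 0)"
  using \<open>0 \<le> t\<close> \<open>2 * \<kappa> * t \<le> real n\<close>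
proof (induction n arbitrary: t)
  case 0
  then have "t = 0"
    using \<kappa> by (simp add: mult_le_0_iff)
  then show ?case by simp
next
  case (Suc n)
  \<comment> \<open>Going back by \<open>1 / (2 * \<kappa>)\<close>, cut off at time zero, uses up
    one unit of \<open>n\<close> and keeps \<open>\<kappa> * (t - x)\<close> at most one
    half.\<close>
  define x where "x = max 0 (t - 1 / (2 * \<kappa>))"
  have x: "0 \<le> x" "x \<le> t" "\<kappa> * (t - x) \<le> 1 / 2" "2 * \<kappa> * x \<le> real n"
  proof -
    have half: "\<kappa> * (1 / (2 * \<kappa>)) = 1 / 2" using \<kappa> by simp
    show "0 \<le> x" "x \<le> t" using Suc.prems \<kappa> by (auto simp: x_def)
    show "\<kappa> * (t - x) \<le> 1 / 2"
      using mult_left_mono[of "t - x" "1 / (2 * \<kappa>)" \<kappa>] half \<kappa> by (simp add: x_def)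
    have "2 * (\<kappa> * (t - 1 / (2 * \<kappa>))) \<le> real n"
      using Suc.prems half by (simp add: right_diff_distrib)
    then show "2 * \<kappa> * x \<le> real n" by (simp add: x_def max_def)
  qed
  have cont': "continuous_on {x..y} z" for y
    using cont by (rule continuous_on_subset) (use x in auto)
  \<comment> \<open>A maximum point \<open>y\<close> turns the derivative bound into the constant
    \<open>\<kappa> * norm (z y)\<close>. Integrated, it is at most half of
    \<open>norm (z y)\<close> and is absorbed on the left.\<close>
  have "\<exists>y\<in>{x..t}. \<forall>r\<in>{x..t}. norm (z r) \<le> norm (z y)"
    using x by (intro continuous_attains_sup continuous_on_norm cont') auto
  then obtain y where y: "y \<in> {x..t}" and ymax: "\<And>r. r \<in> {x..t} \<Longrightarrow> norm (z r) \<le> norm (z y)"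
    by blast
  have "norm (z y - z x) \<le> \<kappa> * norm (z y) * (y - x)"
  proof (rule norm_diff_le_of_derivative_bound[where z' = z'])
    fix r assume r: "x < r" "r < y"
    have "norm (z' r) \<le> \<kappa> * norm (z r)"
      using bound r x by simp
    also have "\<dots> \<le> \<kappa> * norm (z y)"
      using ymax[of r] r y \<kappa> by (intro mult_left_mono) auto
    finally show "norm (z' r) \<le> \<kappa> * norm (z y)" .
  qed (use x y cont' deriv in auto)
  also have "\<dots> = \<kappa> * (y - x) * norm (z y)" by simp
  also have "\<dots> \<le> 1 / 2 * norm (z y)"
  proof (rule mult_right_mono)
    have "\<kappa> * (y - x) \<le> \<kappa> * (t - x)"
      using y \<kappa> by (intro mult_left_mono) auto
    then show "\<kappa> * (y - x) \<le> 1 / 2" using x by linarith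
  qed simp
  finally have "norm (z y) \<le> 2 * norm (z x)"
    using norm_triangle_sub[of "z y" "z x"] by linarith
  moreover have "norm (z t) \<le> norm (z y)"
    using ymax x by simp
  moreover have "norm (z x) \<le> 2 ^ n * norm (z 0)"
    using Suc.IH x by blast
  ultimately show ?case by simp
qed

text \<open>The difference of two solutions obeys the doubling bound. Integrating its derivative
  with that bound inserted shows that the flow minus the identity has a Lipschitz constant
  proportional to \<open>t\<close>, one source of the order gained per sweep.\<close>

lemma solves_ode_difference:
  assumes x: "solves_ode D F 0 v x" and y: "solves_ode D F 0 w y"
    and lip: "\<And>v w. v \<in> D \<Longrightarrow> w \<in> D \<Longrightarrow> norm (F v - F w) \<le> \<kappa> * norm (v - w)"
    and \<kappa>: "0 < \<kappa>" and t: "0 \<le> t" "2 * \<kappa> * t \<le> real n"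
  shows "norm (x t - y t) \<le> 2 ^ n * norm (v - w)"
    and "norm (x t - y t - (v - w)) \<le> \<kappa> * 2 ^ n * norm (v - w) * t"
proof -
  define z where "z = (\<lambda>t. x t - y t)"
  define z' where "z' = (\<lambda>t. F (x t) - F (y t))"
  have z0: "z 0 = v - w" and cont: "continuous_on {0..} z"
    using x y by (auto simp: z_def solves_ode_def intro: continuous_on_diff)
  have deriv: "(z has_vector_derivative z' r) (at r)" if "0 < r" for r
    using x y that unfolding z_def z'_def solves_ode_def
    by (intro has_vector_derivative_diff) auto
  have bound: "norm (z' r) \<le> \<kappa> * norm (z r)" if "0 < r" for r
    using x y that by (auto simp: z_def z'_def solves_ode_def intro!: lip)
  have growth: "norm (z r) \<le> 2 ^ n * norm (v - w)" if "0 \<le> r" "r \<le> t" for r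
  proof -
    have "2 * \<kappa> * r \<le> 2 * \<kappa> * t" using that \<kappa> by simp
    then show ?thesis
      using norm_growth_doubling[OF cont deriv bound \<kappa> that(1), of n] t z0 by simp
  qed
  show "norm (x t - y t) \<le> 2 ^ n * norm (v - w)"
    using growth[of t] t by (simp add: z_def)
  have "norm (z t - z 0) \<le> \<kappa> * (2 ^ n * norm (v - w)) * (t - 0)"
  proof (rule norm_diff_le_of_derivative_bound[where z' = z'])
    fix r assume r: "0 < r" "r < t"
    have "norm (z' r) \<le> \<kappa> * norm (z r)" using bound r by simp
    also have "\<dots> \<le> \<kappa> * (2 ^ n * norm (v - w))"
      using growth[of r] r \<kappa> by (intro mult_left_mono) auto
    finally show "norm (z' r) \<le> \<kappa> * (2 ^ n * norm (v - w))" .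
  qed (use t deriv continuous_on_subset[OF cont] in auto)
  then show "norm (x t - y t - (v - w)) \<le> \<kappa> * 2 ^ n * norm (v - w) * t"
    unfolding z0 by (simp add: z_def mult.assoc)
qed

lemma solves_ode_shift:
  assumes "solves_ode D F t0 u0 u" "t0 \<le> r"
  shows "solves_ode D F 0 (u r) (\<lambda>t. u (r + t))"
proof -
  have "((\<lambda>t. u (r + t)) has_vector_derivative F (u (r + t))) (at t)" if "0 < t" for t
  proof -
    have "((u \<circ> (\<lambda>t. r + t)) has_vector_derivative 1 *\<^sub>R F (u (r + t))) (at t)"
      using assms that
      by (intro vector_diff_chain_at)
         (auto simp: solves_ode_def intro!: derivative_eq_intros simp flip: has_real_derivative_iff_has_vector_derivative)
    then show ?thesis by (simp add: o_def)
  qed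
  moreover have "continuous_on {0..} (\<lambda>t. u (r + t))"
  proof (rule continuous_on_compose2[where g = u and f = "\<lambda>t. r + t"])
    show "continuous_on {t0..} u" using assms by (simp add: solves_ode_def)
    show "continuous_on {0..} (\<lambda>t. r + t)" by (intro continuous_intros)
  qed (use assms in auto)
  ultimately show ?thesis
    using assms by (auto simp: solves_ode_def)
qed

text \<open>Uniqueness: both sides solve the equation from the same initial value, so the growth
  bound is a multiple of zero.\<close>

lemma solves_ode_eq_flow:
  assumes u: "solves_ode D F t0 u0 u" and T: "solution_operator D F T"
    and lip: "\<And>v w. v \<in> D \<Longrightarrow> w \<in> D \<Longrightarrow> norm (F v - F w) \<le> \<kappa> * norm (v - w)"
    and \<kappa>: "0 < \<kappa>" and r: "t0 \<le> r" "0 \<le> h"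
  shows "u (r + h) = T h (u r)"
proof -
  have "u r \<in> D" using u r by (simp add: solves_ode_def)
  then have Tr: "solves_ode D F 0 (u r) (\<lambda>t. T t (u r))"
    using T by (simp add: solution_operator_def)
  obtain n where "2 * \<kappa> * h \<le> real n" using real_arch_simple by blast
  with solves_ode_difference(1)[OF solves_ode_shift[OF u r(1)] Tr lip \<kappa> r(2)]
  have "norm (u (r + h) - T h (u r)) \<le> 0" by simp
  then show ?thesis by simp
qed

text \<open>Converts the integrals of (iii) into increments of the exact solution. The interior form
  of the fundamental theorem fits because the derivative is prescribed only after
  \<open>t0\<close>.\<close>

lemma solves_ode_increment:
  assumes u: "solves_ode D F t0 u0 u" and "t0 \<le> x" "x \<le> y"
  shows "integral {x..y} (\<lambda>\<tau>. F (u \<tau>)) = u y - u x"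
proof (rule integral_unique, rule fundamental_theorem_of_calculus_interior)
  show "continuous_on {x..y} u"
    using assms continuous_on_subset[of "{t0..}" u "{x..y}"] by (auto simp: solves_ode_def)
qed (use assms in \<open>auto simp: solves_ode_def\<close>)

text \<open>\<open>S\<close> minus the identity is split into \<open>T\<close> minus the identity,
  controlled by the flow estimate, and \<open>S\<close> minus \<open>T\<close>, controlled by (v)
  with \<open>h ^ (ph + 1)\<close> lowered to \<open>h\<close>.\<close>

lemma one_step_defect:
  assumes T: "solution_operator D F T"
    and lip: "\<And>v w. v \<in> D \<Longrightarrow> w \<in> D \<Longrightarrow> norm (F v - F w) \<le> \<kappa> * norm (v - w)"
    and \<kappa>: "0 < \<kappa>" and h: "0 \<le> h" "h \<le> M" "2 * \<kappa> * M \<le> real n"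
    and D: "v \<in> D" "w \<in> D"
    and C5: "0 \<le> C5"
    and TS: "norm (T h v - S h v - (T h w - S h w)) \<le> C5 * h ^ (ph + 1) * norm (v - w)"
  shows "norm (v - w - (S h v - S h w)) \<le> (\<kappa> * 2 ^ n + C5 * M ^ ph) * h * norm (v - w)"
proof -
  have "2 * \<kappa> * h \<le> 2 * \<kappa> * M" using h \<kappa> by simp
  then have hn: "2 * \<kappa> * h \<le> real n" using h by linarith
  have "norm (T h v - T h w - (v - w)) \<le> \<kappa> * 2 ^ n * norm (v - w) * h"
    using T D hn h by (intro solves_ode_difference(2)[OF _ _ lip \<kappa>]) (auto simp: solution_operator_def)
  moreover have "C5 * h ^ (ph + 1) * norm (v - w) \<le> C5 * M ^ ph * h * norm (v - w)"
    using power_le_bounded[of h M 1 "ph + 1"] h C5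
    by (intro mult_right_mono) (auto simp: mult.assoc intro!: mult_left_mono)
  moreover have "v - w - (S h v - S h w)
      = (T h v - S h v - (T h w - S h w)) - (T h v - T h w - (v - w))" by simp
  ultimately show ?thesis
    using TS norm_triangle_ineq4[of "T h v - S h v - (T h w - S h w)" "T h v - T h w - (v - w)"]
    by (simp add: algebra_simps)
qed

section \<open>Algebra of sweeps, quadrature and nodes\<close>

lemma dcs_at_0 [simp]: "dcs s c a F S u0 \<Delta>t l 0 = u0"
  by (cases l) auto

text \<open>The first substep needs no separate treatment: its two splitting terms cancel.\<close>

lemma dcs_Suc_step:
  assumes "1 \<le> i"
  shows "dcs s c a F S u0 \<Delta>t (Suc l) i =
    dcs s c a F S u0 \<Delta>t l (i - 1) + quad_sub s a F \<Delta>t i (dcs s c a F S u0 \<Delta>t l)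
    + S ((c i - c (i - 1)) * \<Delta>t) (dcs s c a F S u0 \<Delta>t (Suc l) (i - 1))
    - S ((c i - c (i - 1)) * \<Delta>t) (dcs s c a F S u0 \<Delta>t l (i - 1))"
proof -
  obtain j where "i = Suc j" using assms by (cases i) auto
  then show ?thesis by (cases j) (auto simp: dcs_hat_def)
qed

text \<open>Telescopes because \<open>quad_from0\<close> vanishes at index zero; this links the
  local quadrature defects to that of the full step.\<close>

lemma sum_quad_sub:
  "(\<Sum>i=1..n. quad_sub s a F \<Delta>t i U) = quad_from0 s a F \<Delta>t n U"
  by (induction n) (auto simp: quad_sub_def quad_from0_def)

lemma collocation_nodes_bounds:
  assumes "collocation_nodes s c" "i \<in> {1..s}"
  shows "c (i - 1) < c i" "0 \<le> c (i - 1)" "c i \<le> 1"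
proof -
  have step: "\<And>j. j < s \<Longrightarrow> c j < c (Suc j)" and ends: "c 0 = 0" "c s = 1"
    using assms(1) by (auto simp: collocation_nodes_def)
  have mono: "c m \<le> c n" if "m \<le> n" "n \<le> s" for m n
    using that
  proof (induction n)
    case (Suc n)
    then show ?case using step[of n] by (cases "m = Suc n") auto
  qed simp
  show "c (i - 1) < c i" using step[of "i - 1"] assms(2) by auto
  show "0 \<le> c (i - 1)" "c i \<le> 1"
    using mono[of 0 "i - 1"] mono[of i s] assms(2) ends by auto
qed

section \<open>Order of the error after \<open>k\<close> sweeps\<close>

theorem theorem2:
  fixes D B :: "'a::banach set" and F :: "'a \<Rightarrow> 'a"
    and t0 :: real and u0 :: 'a and u :: "real \<Rightarrow> 'a"
    and T S :: "real \<Rightarrow> 'a \<Rightarrow> 'a"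
    and s p q ph k :: nat
    and c b :: "nat \<Rightarrow> real" and a :: "nat \<Rightarrow> nat \<Rightarrow> real"
    and H :: "real set"
    and \<kappa> C1 C2 C3 C4 C5 C6 :: real
  assumes solution: "solves_ode D F t0 u0 u"
    and flow: "solution_operator D F T"
    and nodes: "collocation_nodes s c"
    and coeffs: "collocation_coeffs s c a b"
    and stiff_acc: "stiffly_accurate s a b"
    and order: "quadrature_order s c b p"
    and stage: "stage_order s c a q"
    and k: "1 \<le> k"
    and pos: "0 < \<kappa>" "0 < C1" "0 < C2" "0 < C3" "0 < C4" "0 < C5" "0 < C6"
    \<comment> \<open>\<open>H\<close> is the range of time steps; \<open>B\<close> is the set of data for which (iv)--(vi) hold\<close>
    and steps: "\<And>\<Delta>t. \<Delta>t \<in> H \<Longrightarrow> 0 < \<Delta>t"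
    and data: "B \<subseteq> D"
    and exact_in: "\<And>\<Delta>t i. \<Delta>t \<in> H \<Longrightarrow> i \<le> s \<Longrightarrow> u (t0 + c i * \<Delta>t) \<in> B"
    and iterates_in: "\<And>\<Delta>t l i. \<Delta>t \<in> H \<Longrightarrow> l \<le> k \<Longrightarrow> i \<le> s \<Longrightarrow> dcs s c a F S u0 \<Delta>t l i \<in> B"
    and i: "\<And>v w. v \<in> D \<Longrightarrow> w \<in> D \<Longrightarrow> norm (F v - F w) \<le> \<kappa> * norm (v - w)"
    and ii: "\<And>\<Delta>t U V i. \<Delta>t \<in> H \<Longrightarrow> (\<forall>j\<in>{1..s}. U j \<in> D \<and> V j \<in> D) \<Longrightarrow> i \<in> {1..s} \<Longrightarrow>
               norm (quad_sub s a F \<Delta>t i U - quad_sub s a F \<Delta>t i V)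
                 \<le> C1 * \<Delta>t * (\<Sum>j=1..s. norm (U j - V j))"
    and iii_sub: "\<And>\<Delta>t i. \<Delta>t \<in> H \<Longrightarrow> i \<in> {1..s} \<Longrightarrow>
               norm (integral {t0 + c (i - 1) * \<Delta>t .. t0 + c i * \<Delta>t} (\<lambda>\<tau>. F (u \<tau>))
                     - quad_sub s a F \<Delta>t i (\<lambda>j. u (t0 + c j * \<Delta>t)))
                 \<le> C2 * \<Delta>t ^ (q + 1)"
    and iii_full: "\<And>\<Delta>t. \<Delta>t \<in> H \<Longrightarrow>
               norm (integral {t0 .. t0 + c s * \<Delta>t} (\<lambda>\<tau>. F (u \<tau>))
                     - quad_from0 s a F \<Delta>t s (\<lambda>j. u (t0 + c j * \<Delta>t)))
                 \<le> C3 * \<Delta>t ^ (p + 1)"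
    and iv: "\<And>\<Delta>t h v. \<Delta>t \<in> H \<Longrightarrow> h \<in> step_lengths s c \<Delta>t \<Longrightarrow> v \<in> B \<Longrightarrow>
               norm (T h v - S h v) \<le> C4 * h ^ (ph + 1)"
    and v: "\<And>\<Delta>t h v w. \<Delta>t \<in> H \<Longrightarrow> h \<in> step_lengths s c \<Delta>t \<Longrightarrow> v \<in> B \<Longrightarrow> w \<in> B \<Longrightarrow>
               norm (T h v - S h v - (T h w - S h w)) \<le> C5 * h ^ (ph + 1) * norm (v - w)"
    and vi: "\<And>\<Delta>t h v w. \<Delta>t \<in> H \<Longrightarrow> h \<in> step_lengths s c \<Delta>t \<Longrightarrow> v \<in> B \<Longrightarrow> w \<in> B \<Longrightarrow>
               norm (S h v - S h w) \<le> (1 + C6 * h) * norm (v - w)"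
    and C1_less: "C1 < 1"
  shows "\<exists>C. C \<ge> Max {C3, C2 * C6, real s * C4 * C1} \<and>
           (\<forall>\<Delta>t\<in>H. C6 * \<Delta>t < 1 \<longrightarrow>
              norm (u (t0 + \<Delta>t) - dcs s c a F S u0 \<Delta>t k s)
                \<le> C * \<Delta>t ^ Min {p + 1, q + 2, ph + k + 1})"
proof -
  \<comment> \<open>\<open>C6 * \<Delta>t < 1\<close> means \<open>\<Delta>t < M\<close>, so
    constants built from \<open>M\<close> are uniform in the time step.\<close>
  define M where "M = 1 / C6"
  obtain n where n: "2 * \<kappa> * M \<le> real n" using real_arch_simple by blast
  \<comment> \<open>\<open>L\<close> is the constant of \<open>one_step_defect\<close>;
    \<open>G\<close> majorizes the growth factor \<open>1 + L * \<Delta>t\<close> per node.\<close>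
  define L where "L = \<kappa> * 2 ^ n + C5 * M ^ ph"
  define G where "G = 1 + L * M"
  define H' where "H' = {\<Delta>t \<in> H. C6 * \<Delta>t < 1}"
  define h where "h = (\<lambda>\<Delta>t i. (c i - c (i - 1)) * \<Delta>t)"
  define x where "x = (\<lambda>\<Delta>t i. u (t0 + c i * \<Delta>t))"
  define y where "y = (\<lambda>l \<Delta>t. dcs s c a F S u0 \<Delta>t l)"
  define E where "E = (\<lambda>l \<Delta>t i. norm (x \<Delta>t i - y l \<Delta>t i))"
  \<comment> \<open>Increments of the exact solution stand in for the integrals of \<open>F\<close>;
    \<open>increment\<close> below identifies the two.\<close>
  define \<delta> where "\<delta> = (\<lambda>\<Delta>t i. x \<Delta>t i - x \<Delta>t (i - 1) - quad_sub s a F \<Delta>t i (x \<Delta>t))"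

  have "0 < M" using pos by (simp add: M_def)
  then have "0 \<le> L" using pos by (simp add: L_def)
  then have "1 \<le> G" using \<open>0 < M\<close> by (simp add: G_def)
  have H': "\<Delta>t \<in> H" "0 < \<Delta>t" "\<Delta>t \<le> M" if "\<Delta>t \<in> H'" for \<Delta>t
    using that steps pos by (auto simp: H'_def M_def field_simps intro: less_imp_le)
  have c0: "c 0 = 0" "c s = 1" "1 \<le> s" using nodes by (auto simp: collocation_nodes_def)
  note cb = collocation_nodes_bounds[OF nodes]
  have E_nonneg: "0 \<le> E l \<Delta>t i" for l \<Delta>t i by (simp add: E_def)
  have E_0: "E l \<Delta>t 0 = 0" for l \<Delta>t
    using solution c0 by (simp add: E_def x_def y_def solves_ode_def)

  have h: "0 \<le> h \<Delta>t i" "h \<Delta>t i \<le> \<Delta>t" "h \<Delta>t i \<in> step_lengths s c \<Delta>t"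
    if "\<Delta>t \<in> H'" "i \<in> {1..s}" for \<Delta>t i
  proof -
    have "(c i - c (i - 1)) * \<Delta>t \<le> 1 * \<Delta>t"
      using cb[OF that(2)] H'[OF that(1)] by (intro mult_right_mono) linarith+
    then show "0 \<le> h \<Delta>t i" "h \<Delta>t i \<le> \<Delta>t" "h \<Delta>t i \<in> step_lengths s c \<Delta>t"
      using that cb[OF that(2)] H'[OF that(1)] by (auto simp: h_def step_lengths_def)
  qed
  have xB: "x \<Delta>t i \<in> B" if "\<Delta>t \<in> H'" "i \<le> s" for \<Delta>t i
    using exact_in H' that by (simp add: x_def)
  have yB: "y l \<Delta>t i \<in> B" if "\<Delta>t \<in> H'" "l \<le> k" "i \<le> s" for l \<Delta>t i
    using iterates_in H' that by (simp add: y_def)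
  have pred: "i - 1 \<le> s" if "i \<in> {1..s}" for i using that by auto

  \<comment> \<open>Propagation of errors through one splitting substep\<close>
  have defect: "norm (x \<Delta>t (i - 1) - y l \<Delta>t (i - 1)
        - (S (h \<Delta>t i) (x \<Delta>t (i - 1)) - S (h \<Delta>t i) (y l \<Delta>t (i - 1)))) \<le> L * \<Delta>t * E l \<Delta>t (i - 1)"
    (is "norm ?d \<le> _") if "\<Delta>t \<in> H'" "l \<le> k" "i \<in> {1..s}" for l \<Delta>t i
  proof -
    have B: "x \<Delta>t (i - 1) \<in> B" "y l \<Delta>t (i - 1) \<in> B"
      using xB yB pred that by auto
    have "norm ?d \<le> L * h \<Delta>t i * E l \<Delta>t (i - 1)"
      unfolding L_def E_def
      using h[OF that(1,3)] H'[OF that(1)] n pos B data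
      by (intro one_step_defect[OF flow i] v) auto
    also have "\<dots> \<le> L * \<Delta>t * E l \<Delta>t (i - 1)"
      using h[OF that(1,3)] \<open>0 \<le> L\<close> E_nonneg by (intro mult_right_mono mult_left_mono) auto
    finally show ?thesis .
  qed
  have defect_G: "L * \<Delta>t * E l \<Delta>t i \<le> (G - 1) * E l \<Delta>t i" if "\<Delta>t \<in> H'" for l \<Delta>t i
    using H'[OF that] \<open>0 \<le> L\<close> E_nonneg by (auto simp: G_def intro!: mult_right_mono mult_left_mono)

  have x_step: "x \<Delta>t i = T (h \<Delta>t i) (x \<Delta>t (i - 1))" if "\<Delta>t \<in> H'" "i \<in> {1..s}" for \<Delta>t i
  proof -
    have "t0 + c i * \<Delta>t = t0 + c (i - 1) * \<Delta>t + h \<Delta>t i"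
      by (simp add: h_def algebra_simps)
    moreover have "0 \<le> c (i - 1) * \<Delta>t" using cb[OF that(2)] H'[OF that(1)] by simp
    ultimately show ?thesis
      using solves_ode_eq_flow[OF solution flow i \<open>0 < \<kappa>\<close>, of "t0 + c (i - 1) * \<Delta>t" "h \<Delta>t i"]
        h[OF that] by (simp add: x_def add.assoc)
  qed

  have init_step: "E 0 \<Delta>t i \<le> G * E 0 \<Delta>t (i - 1) + C4 * \<Delta>t ^ (ph + 1)"
    if "\<Delta>t \<in> H'" "i \<in> {1..s}" for \<Delta>t i
  proof -
    let ?X = "x \<Delta>t (i - 1)" and ?Y = "y 0 \<Delta>t (i - 1)" and ?S = "S (h \<Delta>t i)"
    have "y 0 \<Delta>t i = ?S ?Y"
      using that by (cases i) (auto simp: y_def h_def)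
    \<comment> \<open>The local error (iv) is taken at the exact value; the rest, the old error
      propagated by \<open>S\<close>, is that error minus its defect.\<close>
    then have "x \<Delta>t i - y 0 \<Delta>t i
        = (T (h \<Delta>t i) ?X - ?S ?X) + (?X - ?Y) - (?X - ?Y - (?S ?X - ?S ?Y))"
      using x_step[OF that] by simp
    then have "E 0 \<Delta>t i \<le> norm (T (h \<Delta>t i) ?X - ?S ?X) + E 0 \<Delta>t (i - 1)
        + norm (?X - ?Y - (?S ?X - ?S ?Y))"
      unfolding E_def
      by (simp only: norm_add_diff_le)
    moreover have "norm (T (h \<Delta>t i) ?X - ?S ?X) \<le> C4 * h \<Delta>t i ^ (ph + 1)"
      using h[OF that] H'[OF that(1)] xB[OF that(1) pred[OF that(2)]] by (intro iv)
    moreover have "C4 * h \<Delta>t i ^ (ph + 1) \<le> C4 * \<Delta>t ^ (ph + 1)"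
      using h[OF that] pos by (intro mult_left_mono power_mono) auto
    ultimately show ?thesis
      using defect[OF that(1) _ that(2), of 0] defect_G[OF that(1), of 0 "i - 1"]
      by (simp add: algebra_simps)
  qed

  \<comment> \<open>Quadrature defects and the sweep recursion\<close>
  have increment: "integral {t0 + c i * \<Delta>t .. t0 + c j * \<Delta>t} (\<lambda>\<tau>. F (u \<tau>)) = x \<Delta>t j - x \<Delta>t i"
    if "\<Delta>t \<in> H'" "0 \<le> c i" "c i \<le> c j" for \<Delta>t i j
    using H'[OF that(1)] that unfolding x_def
    by (intro solves_ode_increment[OF solution]) (auto intro: mult_right_mono)
  have \<delta>_bound: "norm (\<delta> \<Delta>t i) \<le> C2 * \<Delta>t ^ (q + 1)" if "\<Delta>t \<in> H'" "i \<in> {1..s}" for \<Delta>t i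
    using iii_sub[OF H'(1)[OF that(1)] that(2)] increment[OF that(1), of "i - 1" i] cb[OF that(2)]
    by (simp add: \<delta>_def x_def)
  \<comment> \<open>The local defects telescope, so the full-step bound of order
    \<open>p + 1\<close> applies in place of \<open>s\<close> copies of the bound of order
    \<open>q + 1\<close>.\<close>
  have \<delta>_sum: "norm (\<Sum>i=1..s. \<delta> \<Delta>t i) \<le> C3 * \<Delta>t ^ (p + 1)" if "\<Delta>t \<in> H'" for \<Delta>t
  proof -
    have "(\<Sum>i=1..m. x \<Delta>t i - x \<Delta>t (i - 1)) = x \<Delta>t m - x \<Delta>t 0" for m
      by (induction m) auto
    then have "(\<Sum>i=1..s. \<delta> \<Delta>t i) = x \<Delta>t s - x \<Delta>t 0 - quad_from0 s a F \<Delta>t s (x \<Delta>t)"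
      unfolding \<delta>_def by (simp only: sum_subtractf sum_quad_sub)
    then show ?thesis
      using iii_full[OF H'(1)[OF that]] increment[OF that, of 0 s] c0 by (simp add: x_def)
  qed

  \<comment> \<open>\<open>\<delta>\<close> stays inside the norm: stagewise it is bounded
    separately, whereas in the final sum the defects must be allowed to cancel.\<close>
  have sweep_step: "norm (x \<Delta>t i - y (Suc l) \<Delta>t i - (x \<Delta>t (i - 1) - y (Suc l) \<Delta>t (i - 1)) - \<delta> \<Delta>t i)
      \<le> C1 * \<Delta>t * (\<Sum>j=1..s. E l \<Delta>t j) + L * \<Delta>t * E l \<Delta>t (i - 1) + L * \<Delta>t * E (Suc l) \<Delta>t (i - 1)"
    if "\<Delta>t \<in> H'" "Suc l \<le> k" "i \<in> {1..s}" for l \<Delta>t i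
  proof -
    let ?X = "x \<Delta>t (i - 1)" and ?Y = "y l \<Delta>t (i - 1)" and ?Z = "y (Suc l) \<Delta>t (i - 1)"
      and ?S = "S (h \<Delta>t i)"
    let ?Q = "quad_sub s a F \<Delta>t i (x \<Delta>t) - quad_sub s a F \<Delta>t i (y l \<Delta>t)"
    have "y (Suc l) \<Delta>t i = ?Y + quad_sub s a F \<Delta>t i (y l \<Delta>t) + ?S ?Z - ?S ?Y"
      using that(3) unfolding y_def h_def by (intro dcs_Suc_step) simp
    \<comment> \<open>\<open>S\<close> at the exact value is added and subtracted, which turns the
      two splitting terms into defects of the old and the new iterate.\<close>
    then have "x \<Delta>t i - y (Suc l) \<Delta>t i - (?X - ?Z) - \<delta> \<Delta>t i
        = ?Q + (?X - ?Y - (?S ?X - ?S ?Y)) - (?X - ?Z - (?S ?X - ?S ?Z))"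
      by (simp add: \<delta>_def algebra_simps)
    then have "norm (x \<Delta>t i - y (Suc l) \<Delta>t i - (?X - ?Z) - \<delta> \<Delta>t i)
        \<le> norm ?Q + norm (?X - ?Y - (?S ?X - ?S ?Y)) + norm (?X - ?Z - (?S ?X - ?S ?Z))"
      by (simp only: norm_add_diff_le)
    also have "\<dots> \<le> C1 * \<Delta>t * (\<Sum>j=1..s. E l \<Delta>t j) + L * \<Delta>t * E l \<Delta>t (i - 1) + L * \<Delta>t * E (Suc l) \<Delta>t (i - 1)"
    proof (intro add_mono)
      have "\<forall>j\<in>{1..s}. x \<Delta>t j \<in> D \<and> y l \<Delta>t j \<in> D"
        by (intro ballI conjI subsetD[OF data] xB yB) (use that in simp_all)
      then show "norm ?Q \<le> C1 * \<Delta>t * (\<Sum>j=1..s. E l \<Delta>t j)"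
        unfolding E_def by (rule ii[OF H'(1)[OF that(1)] _ that(3)])
    qed (rule defect; use that in simp)+
    finally show ?thesis .
  qed

  \<comment> \<open>Order of all stage errors, by induction over the sweeps\<close>
  have stages: "\<exists>A\<ge>0. \<forall>\<Delta>t\<in>H'. \<forall>i\<le>s. E l \<Delta>t i \<le> A * \<Delta>t ^ min (q + 1) (ph + l + 1)"
    if "l \<le> k" for l
    using that
  proof (induction l)
    case 0
    let ?m = "min (q + 1) (ph + 0 + 1)"
    let ?A = "real s * G ^ s * (C4 * M ^ (ph + 1 - ?m))"
    have "E 0 \<Delta>t i \<le> ?A * \<Delta>t ^ ?m" if "\<Delta>t \<in> H'" "i \<le> s" for \<Delta>t i
    proof -
      have "E 0 \<Delta>t i \<le> real s * G ^ s * (C4 * \<Delta>t ^ (ph + 1))"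
        using E_0 \<open>1 \<le> G\<close> pos H'[OF that(1)] init_step[OF that(1)] that(2)
        by (intro discrete_gronwall) auto
      also have "\<dots> \<le> real s * G ^ s * (C4 * (M ^ (ph + 1 - ?m) * \<Delta>t ^ ?m))"
        using H'[OF that(1)] \<open>1 \<le> G\<close> pos
        by (intro mult_left_mono power_le_bounded) auto
      finally show ?thesis by (simp add: mult.assoc)
    qed
    moreover have "0 \<le> ?A" using \<open>1 \<le> G\<close> pos \<open>0 < M\<close> by simp
    ultimately show ?case by blast
  next
    case (Suc l)
    let ?m = "min (q + 1) (ph + l + 1)" and ?m' = "min (q + 1) (ph + Suc l + 1)"
    obtain A where A: "0 \<le> A" "\<And>\<Delta>t i. \<Delta>t \<in> H' \<Longrightarrow> i \<le> s \<Longrightarrow> E l \<Delta>t i \<le> A * \<Delta>t ^ ?m"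
      using Suc by auto
    \<comment> \<open>\<open>K\<close> collects the terms of the old iterate: quadrature over
      \<open>s\<close> stages and the propagated defect. Their extra \<open>\<Delta>t\<close> gives
      the exponent \<open>?m + 1\<close>, which is at least \<open>?m'\<close>.\<close>
    define K where "K = C1 * real s * A + L * A"
    let ?b = "C2 * M ^ (q + 1 - ?m') + K * M ^ (?m + 1 - ?m')"
    have "0 \<le> K" using pos A \<open>0 \<le> L\<close> by (simp add: K_def)
    have "E (Suc l) \<Delta>t i \<le> (real s * G ^ s * ?b) * \<Delta>t ^ ?m'" if t: "\<Delta>t \<in> H'" and "i \<le> s" for \<Delta>t i
    proof -
      note ht = H'[OF t]
      have "E (Suc l) \<Delta>t i \<le> real s * G ^ s * (?b * \<Delta>t ^ ?m')"
      proof (rule discrete_gronwall)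
        fix i assume i: "i \<in> {1..s}"
        have "(\<Sum>j=1..s. E l \<Delta>t j) \<le> real s * (A * \<Delta>t ^ ?m)"
          using A(2)[OF t] sum_bounded_above[of "{1..s}" "E l \<Delta>t" "A * \<Delta>t ^ ?m"] by simp
        then have "C1 * \<Delta>t * (\<Sum>j=1..s. E l \<Delta>t j) + L * \<Delta>t * E l \<Delta>t (i - 1)
            \<le> C1 * \<Delta>t * (real s * (A * \<Delta>t ^ ?m)) + L * \<Delta>t * (A * \<Delta>t ^ ?m)"
          using A(2)[OF t pred[OF i]] pos \<open>0 \<le> L\<close> ht
          by (intro add_mono mult_left_mono) auto
        also have "\<dots> = K * \<Delta>t ^ (?m + 1)" by (simp add: K_def algebra_simps)
        also have "\<dots> \<le> K * (M ^ (?m + 1 - ?m') * \<Delta>t ^ ?m')"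
          using ht \<open>0 \<le> K\<close> by (intro mult_left_mono power_le_bounded) auto
        finally have 1: "C1 * \<Delta>t * (\<Sum>j=1..s. E l \<Delta>t j) + L * \<Delta>t * E l \<Delta>t (i - 1)
            \<le> K * (M ^ (?m + 1 - ?m') * \<Delta>t ^ ?m')" .
        have "C2 * \<Delta>t ^ (q + 1) \<le> C2 * (M ^ (q + 1 - ?m') * \<Delta>t ^ ?m')"
          using ht pos by (intro mult_left_mono power_le_bounded) auto
        then have 2: "norm (\<delta> \<Delta>t i) \<le> C2 * (M ^ (q + 1 - ?m') * \<Delta>t ^ ?m')"
          using \<delta>_bound[OF t i] by linarith
        let ?X = "x \<Delta>t (i - 1) - y (Suc l) \<Delta>t (i - 1)"
        let ?r = "x \<Delta>t i - y (Suc l) \<Delta>t i - ?X - \<delta> \<Delta>t i"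
        have "norm (?r + ?X + \<delta> \<Delta>t i) \<le> norm ?r + norm ?X + norm (\<delta> \<Delta>t i)"
          by (intro norm_triangle_mono order_refl)
        then have "E (Suc l) \<Delta>t i \<le> norm ?r + E (Suc l) \<Delta>t (i - 1) + norm (\<delta> \<Delta>t i)"
          unfolding E_def by simp
        \<comment> \<open>The defect of the new iterate at the preceding node is absorbed into
          \<open>G\<close>.\<close>
        then show "E (Suc l) \<Delta>t i \<le> G * E (Suc l) \<Delta>t (i - 1) + ?b * \<Delta>t ^ ?m'"
          using sweep_step[OF t Suc.prems i] defect_G[OF t, of "Suc l" "i - 1"] 1 2
          by (simp add: algebra_simps)
      next
        show "0 \<le> ?b * \<Delta>t ^ ?m'"
          using pos \<open>0 \<le> K\<close> \<open>0 < M\<close> ht by simp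
      qed (use E_0 \<open>1 \<le> G\<close> \<open>i \<le> s\<close> in auto)
      then show ?thesis by (simp only: mult.assoc)
    qed
    moreover have "0 \<le> real s * G ^ s * ?b"
      using \<open>1 \<le> G\<close> pos \<open>0 < M\<close> \<open>0 \<le> K\<close> by simp
    ultimately show ?case by blast
  qed

  \<comment> \<open>Error at the end of the full step\<close>
  obtain l where kl: "k = Suc l" using k by (cases k) auto
  let ?m = "min (q + 1) (ph + l + 1)" and ?m' = "min (q + 1) (ph + k + 1)"
  \<comment> \<open>As \<open>k = Suc l\<close>, \<open>?m + 1\<close> equals
    \<open>min (q + 2) (ph + k + 1)\<close>; hence \<open>?N\<close> is the smaller of
    \<open>p + 1\<close> and \<open>?m + 1\<close>.\<close>
  let ?N = "Min {p + 1, q + 2, ph + k + 1}"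
  obtain A where A: "0 \<le> A" "\<And>\<Delta>t i. \<Delta>t \<in> H' \<Longrightarrow> i \<le> s \<Longrightarrow> E l \<Delta>t i \<le> A * \<Delta>t ^ ?m"
    using stages[of l] kl by auto
  obtain A' where A': "0 \<le> A'" "\<And>\<Delta>t i. \<Delta>t \<in> H' \<Longrightarrow> i \<le> s \<Longrightarrow> E k \<Delta>t i \<le> A' * \<Delta>t ^ ?m'"
    using stages[of k] by auto
  \<comment> \<open>The third term accounts for the new iterate, whose exponent \<open>?m'\<close>
    is lowered to \<open>?m\<close> to match the old one.\<close>
  define K where "K = C1 * real s * A + L * A + L * (A' * M ^ (?m' - ?m))"
  have "0 \<le> K" using pos A(1) A'(1) \<open>0 \<le> L\<close> \<open>0 < M\<close> by (simp add: K_def)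
  define C where "C = C3 * M ^ (p + 1 - ?N) + real s * K * M ^ (?m + 1 - ?N)"

  have main: "E k \<Delta>t s \<le> C * \<Delta>t ^ ?N" if t: "\<Delta>t \<in> H'" for \<Delta>t
  proof -
    note ht = H'[OF t]
    define r where "r = (\<lambda>i. x \<Delta>t i - y k \<Delta>t i - (x \<Delta>t (i - 1) - y k \<Delta>t (i - 1)) - \<delta> \<Delta>t i)"
    have r: "norm (r i) \<le> K * \<Delta>t ^ (?m + 1)" if i: "i \<in> {1..s}" for i
    proof -
      have "(\<Sum>j=1..s. E l \<Delta>t j) \<le> real s * (A * \<Delta>t ^ ?m)"
        using A(2)[OF t] sum_bounded_above[of "{1..s}" "E l \<Delta>t" "A * \<Delta>t ^ ?m"] by simp
      moreover have "E k \<Delta>t (i - 1) \<le> A' * (M ^ (?m' - ?m) * \<Delta>t ^ ?m)"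
      proof -
        have "E k \<Delta>t (i - 1) \<le> A' * \<Delta>t ^ ?m'" using A'(2)[OF t pred[OF i]] .
        also have "\<dots> \<le> A' * (M ^ (?m' - ?m) * \<Delta>t ^ ?m)"
          using ht A'(1) kl by (intro mult_left_mono power_le_bounded) auto
        finally show ?thesis .
      qed
      ultimately have "C1 * \<Delta>t * (\<Sum>j=1..s. E l \<Delta>t j) + L * \<Delta>t * E l \<Delta>t (i - 1) + L * \<Delta>t * E k \<Delta>t (i - 1)
          \<le> C1 * \<Delta>t * (real s * (A * \<Delta>t ^ ?m)) + L * \<Delta>t * (A * \<Delta>t ^ ?m)
            + L * \<Delta>t * (A' * (M ^ (?m' - ?m) * \<Delta>t ^ ?m))"
        using A(2)[OF t pred[OF i]] pos \<open>0 \<le> L\<close> ht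
        by (intro add_mono mult_left_mono) auto
      also have "\<dots> = K * \<Delta>t ^ (?m + 1)" by (simp add: K_def algebra_simps)
      finally show ?thesis
        using sweep_step[OF t _ i, of l] kl unfolding r_def by simp
    qed
    have "(\<Sum>i=1..m. r i + \<delta> \<Delta>t i) = x \<Delta>t m - y k \<Delta>t m - (x \<Delta>t 0 - y k \<Delta>t 0)" for m
      by (induction m) (auto simp: r_def)
    moreover have "x \<Delta>t 0 - y k \<Delta>t 0 = 0" using E_0[of k \<Delta>t] by (simp add: E_def)
    ultimately have "x \<Delta>t s - y k \<Delta>t s = (\<Sum>i=1..s. r i) + (\<Sum>i=1..s. \<delta> \<Delta>t i)"
      by (simp add: sum.distrib)
    then have "E k \<Delta>t s \<le> norm (\<Sum>i=1..s. r i) + norm (\<Sum>i=1..s. \<delta> \<Delta>t i)"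
      unfolding E_def by (simp add: norm_triangle_ineq)
    also have "\<dots> \<le> real s * (K * \<Delta>t ^ (?m + 1)) + C3 * \<Delta>t ^ (p + 1)"
      using sum_norm_bound[of "{1..s}" r, OF r] \<delta>_sum[OF t] by (intro add_mono) auto
    also have "\<dots> \<le> real s * (K * (M ^ (?m + 1 - ?N) * \<Delta>t ^ ?N)) + C3 * (M ^ (p + 1 - ?N) * \<Delta>t ^ ?N)"
      using ht \<open>0 \<le> K\<close> pos kl by (intro add_mono mult_left_mono power_le_bounded) auto
    finally show ?thesis by (simp add: C_def algebra_simps)
  qed

  \<comment> \<open>Enlarging \<open>C\<close> enforces the required lower bound and keeps the
    estimate, since powers of \<open>\<Delta>t\<close> are nonnegative.\<close>
  let ?C = "max C (Max {C3, C2 * C6, real s * C4 * C1})"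
  have "norm (u (t0 + \<Delta>t) - dcs s c a F S u0 \<Delta>t k s) \<le> ?C * \<Delta>t ^ ?N"
    if "\<Delta>t \<in> H" "C6 * \<Delta>t < 1" for \<Delta>t
  proof -
    have t: "\<Delta>t \<in> H'" using that by (simp add: H'_def)
    have "E k \<Delta>t s \<le> C * \<Delta>t ^ ?N" by (rule main[OF t])
    also have "\<dots> \<le> ?C * \<Delta>t ^ ?N"
      using H'[OF t] by (intro mult_right_mono zero_le_power max.cobounded1) simp
    finally show ?thesis using c0 by (simp add: E_def x_def y_def)
  qed
  then show ?thesis by (intro exI[of _ ?C]) auto
qed

end
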